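(* Consider CMS-CU with $d$ rows and $w$ counters per row, fed with an IRM request stream, as described in the context. For every item $i\in I$ there exists a constant $B_i\ge 0$ such that for every $t\ge 1$, $$\mathbb{E}\!\left[\frac{e_i(t)}{t}\right]\le \frac{1}{w}\sum_{j\in I\setminus\{i\}}p_j\,\gamma_{i,j}+\frac{B_i}{t},$$ where $$\gamma_{i,j}=\begin{cases}1,& j\le i,\\ \min\big(\mathcal{A}(p_i-p_j)^{d-1},\,1\big),& j>i,\end{cases}$$ with $\mathcal{A}(x)=\min_{k=0,\dots,w-1}\left(\frac{\sum_{l>k}p_l}{(w-k)x}+\frac{k}{w}\right)$ for $x>0$ and $\mathcal{A}(0)=1$.
   Context: Items form the universe $I=\{1,\dots,N\}$. Requests follow the Independent Reference Model (IRM): the stream is $Z(1),Z(2),\dots$ with $Z(s)$ i.i.d. categorical random variables, $\Pr(Z(s)=i)=p_i$, $\sum_{i\in I}p_i=1$, and items are numbered so that $p_1\ge p_2\ge\dots\ge p_N$. The sketch is a $d\times w$ array of counters, initially $0$. Hash functions $h_1,\dots,h_d:I\to\{1,\dots,w\}$ are chosen independently and uniformly at random from a family of pairwise independent hash functions (so $\Pr(h_r(i)=h_r(j))=1/w$ for $i\ne j$), independently of the request stream, and are fixed during processing. $c_i^r(t)$ denotes the value at time $t$ of the counter in row $r$, column $h_r(i)$. CMS-CU update: when item $i$ is requested at time $t$, $c_i^r(t)=\max\big(c_i^r(t-1),\ \min_{f\in[d]}c_i^f(t-1)+1\big)$ for all $r\in[d]$ (other counters unchanged). $n_i(t)$ is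 the number of occurrences of item $i$ among $Z(1),\dots,Z(t)$; the estimate is $\hat n_i(t)=\min_{r\in[d]}c_i^r(t)$ and the estimation error is $e_i(t)=\hat n_i(t)-n_i(t)$. Expectations are taken over both the random choice of hash functions and the request process. *)

theory Defs
  imports Complex_Main "HOL-Library.FuncSet"
begin

text \<open>Items are 1..N, rows are 1..d, columns are 1..w.
  A counter array is a function C :: row => column => nat.
  A choice of hash functions is hs :: row => (item => column).\<close>

definition cms_est :: "nat \<Rightarrow> (nat \<Rightarrow> nat \<Rightarrow> nat) \<Rightarrow> (nat \<Rightarrow> nat \<Rightarrow> nat) \<Rightarrow> nat \<Rightarrow> nat" where
  "cms_est d hs C i = Min ((\<lambda>r. C r (hs r i)) ` {1..d})"

definition cu_step :: "nat \<Rightarrow> (nat \<Rightarrow> nat \<Rightarrow> nat) \<Rightarrow> (nat \<Rightarrow> nat \<Rightarrow> nat) \<Rightarrow> nat \<Rightarrow> (nat \<Rightarrow> nat \<Rightarrow> nat)" where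
  "cu_step d hs C i = (\<lambda>r col. if r \<in> {1..d} \<and> col = hs r i
      then max (C r col) (cms_est d hs C i + 1) else C r col)"

definition cu_counters :: "nat \<Rightarrow> (nat \<Rightarrow> nat \<Rightarrow> nat) \<Rightarrow> nat list \<Rightarrow> (nat \<Rightarrow> nat \<Rightarrow> nat)" where
  "cu_counters d hs zs = fold (\<lambda>z C. cu_step d hs C z) zs (\<lambda>_ _. 0)"

definition cu_error :: "nat \<Rightarrow> (nat \<Rightarrow> nat \<Rightarrow> nat) \<Rightarrow> nat list \<Rightarrow> nat \<Rightarrow> real" where
  "cu_error d hs zs i = real (cms_est d hs (cu_counters d hs zs) i) - real (count_list zs i)"

definition pairwise_indep_family :: "nat \<Rightarrow> nat \<Rightarrow> (nat \<Rightarrow> nat) set \<Rightarrow> bool" where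
  "pairwise_indep_family N w H \<longleftrightarrow> finite H \<and> H \<noteq> {} \<and>
     (\<forall>h\<in>H. \<forall>x\<in>{1..N}. h x \<in> {1..w}) \<and>
     (\<forall>x\<in>{1..N}. \<forall>y\<in>{1..N}. x \<noteq> y \<longrightarrow> (\<forall>a\<in>{1..w}. \<forall>b\<in>{1..w}.
        real (card {h\<in>H. h x = a \<and> h y = b}) = real (card H) / (real w)^2))"

text \<open>E[e_i(t)/t]: h_1..h_d i.i.d. uniform on H, Z(1..t) i.i.d. with law p (IRM).\<close>
definition expected_error_ratio :: "nat \<Rightarrow> nat \<Rightarrow> (nat \<Rightarrow> nat) set \<Rightarrow> (nat \<Rightarrow> real) \<Rightarrow> nat \<Rightarrow> nat \<Rightarrow> real" where
  "expected_error_ratio N d H p i t =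
     (\<Sum>hs\<in>({1..d} \<rightarrow>\<^sub>E H). \<Sum>zs\<in>{zs. set zs \<subseteq> {1..N} \<and> length zs = t}.
        prod_list (map p zs) * (cu_error d hs zs i / real t)) / real (card H ^ d)"

definition A_fun :: "nat \<Rightarrow> nat \<Rightarrow> (nat \<Rightarrow> real) \<Rightarrow> real \<Rightarrow> real" where
  "A_fun N w p x = (if x = 0 then 1 else
     Min ((\<lambda>k. (\<Sum>l\<in>{l\<in>{1..N}. l > k}. p l) / (real (w - k) * x) + real k / real w) ` {0..w-1}))"

definition gamma :: "nat \<Rightarrow> nat \<Rightarrow> nat \<Rightarrow> (nat \<Rightarrow> real) \<Rightarrow> nat \<Rightarrow> nat \<Rightarrow> real" where
  "gamma N d w p i j = (if j \<le> i then 1 else min ((A_fun N w p (p i - p j)) ^ (d - 1)) 1)"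

end

theory Submission
  imports Defs
begin

text \<open>
  The estimate of item \<open>i\<close> is at most its counter in row 1. A request for \<open>j \<noteq> i\<close> increases that
  counter only if \<open>j\<close> collides with \<open>i\<close> in row 1 and the estimate of \<open>j\<close> has reached that counter,
  hence is at least the number of requests for \<open>i\<close>. As a counter never exceeds the number of requests
  hashed to it, in every row the requests hashed to the column of \<open>j\<close> then outnumber those for \<open>i\<close>.
  If in some row the column of \<open>j\<close> has total probability less than \<open>p\<^sub>i\<close>, a Chernoff bound makes
  this event geometrically rare, so such hash choices contribute only \<open>O(1)\<close> over all time.
  Otherwise, in each of the \<open>d - 1\<close> remaining rows the items colliding with \<open>j\<close> have mass at
  least \<open>p\<^sub>i - p\<^sub>j\<close>, whose probability is bounded by a union bound over the \<open>k\<close> most popular items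
  and Markov's inequality for the others; rows are independent.
\<close>

subsection \<open>Expectations over i.i.d. words\<close>

text \<open>The finite weighted sum mirrors the inner sum of \<open>expected_error_ratio\<close>; no
  measure space is involved, and \<open>p\<close> is normalised only where a lemma assumes
  it.\<close>

definition word_expect :: "'a set \<Rightarrow> ('a \<Rightarrow> real) \<Rightarrow> nat \<Rightarrow> ('a list \<Rightarrow> real) \<Rightarrow> real" where
  "word_expect A p t f = (\<Sum>zs\<in>{zs. set zs \<subseteq> A \<and> length zs = t}. prod_list (map p zs) * f zs)"

lemma word_expect_0 [simp]: "word_expect A p 0 f = f []"
proof -
  have "{zs. set zs \<subseteq> A \<and> length zs = 0} = {[]}" by auto
  then show ?thesis by (simp add: word_expect_def)
qed

text \<open>Peeling off the last letter amounts to conditioning on the first \<open>t\<close>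
  requests, which suits counters that evolve by appending.\<close>

lemma word_expect_Suc:
  "word_expect A p (Suc t) f = word_expect A p t (\<lambda>zs. \<Sum>z\<in>A. p z * f (zs @ [z]))"
proof -
  let ?L = "\<lambda>t. {zs. set zs \<subseteq> A \<and> length zs = t}"
  have bij: "bij_betw (\<lambda>(zs, z). zs @ [z]) (?L t \<times> A) (?L (Suc t))"
  proof (rule bij_betwI')
    fix ys assume "ys \<in> ?L (Suc t)"
    then obtain zs z where "ys = zs @ [z]" "zs \<in> ?L t" "z \<in> A"
      by (cases ys rule: rev_cases) auto
    then show "\<exists>x\<in>?L t \<times> A. ys = (case x of (zs, z) \<Rightarrow> zs @ [z])" by force
  qed auto
  have "word_expect A p (Suc t) f
      = (\<Sum>(zs, z)\<in>?L t \<times> A. prod_list (map p zs) * (p z * f (zs @ [z])))"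
    unfolding word_expect_def
    by (subst sum.reindex_bij_betw[OF bij, symmetric]) (auto intro!: sum.cong)
  then show ?thesis
    by (simp add: word_expect_def sum.cartesian_product sum_distrib_left)
qed

lemma word_expect_mono:
  assumes "\<And>a. a \<in> A \<Longrightarrow> 0 \<le> p a"
    and "\<And>zs. set zs \<subseteq> A \<Longrightarrow> f zs \<le> g zs"
  shows "word_expect A p t f \<le> word_expect A p t g"
proof -
  have "0 \<le> prod_list (map p zs)" if "set zs \<subseteq> A" for zs
    using that assms(1) by (induction zs) auto
  then show ?thesis
    unfolding word_expect_def by (intro sum_mono mult_left_mono) (auto simp: assms(2))
qed

lemma word_expect_add:
  "word_expect A p t (\<lambda>zs. f zs + g zs) = word_expect A p t f + word_expect A p t g"
  by (simp add: word_expect_def sum.distrib distrib_left)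

lemma word_expect_cmult: "word_expect A p t (\<lambda>zs. c * f zs) = c * word_expect A p t f"
  by (simp add: word_expect_def sum_distrib_left mult.left_commute)

lemma word_expect_sum:
  "word_expect A p t (\<lambda>zs. \<Sum>x\<in>X. f x zs) = (\<Sum>x\<in>X. word_expect A p t (f x))"
  unfolding word_expect_def by (subst sum.swap) (simp add: sum_distrib_left)

lemma word_expect_const: "sum p A = 1 \<Longrightarrow> word_expect A p t (\<lambda>_. c) = c"
  by (induction t) (simp_all add: word_expect_Suc flip: sum_distrib_right)

section \<open>Exponential moments and a Chernoff bound\<close>

lemma word_expect_prod_list:
  "word_expect A p t (\<lambda>zs. prod_list (map g zs)) = (\<Sum>a\<in>A. p a * g a) ^ t"
proof (induction t)
  case (Suc t)
  have "word_expect A p (Suc t) (\<lambda>zs. prod_list (map g zs))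
      = word_expect A p t (\<lambda>zs. (\<Sum>a\<in>A. p a * g a) * prod_list (map g zs))"
    by (simp add: word_expect_Suc sum_distrib_left mult_ac)
  then show ?case by (simp add: word_expect_cmult Suc.IH)
qed simp

text \<open>The moment generating function equals 1 at 0 and its derivative there is the mean, which
  is negative, so it drops below 1 just to the right of 0.\<close>

lemma exp_moment_less_one:
  fixes X :: "'a \<Rightarrow> real"
  assumes "sum p A = 1" and "(\<Sum>a\<in>A. p a * X a) < 0"
  shows "\<exists>\<theta>>0. (\<Sum>a\<in>A. p a * exp (\<theta> * X a)) < 1"
proof -
  have "((\<lambda>\<theta>. \<Sum>a\<in>A. p a * exp (\<theta> * X a)) has_real_derivative (\<Sum>a\<in>A. p a * X a)) (at 0)"
    by (auto intro!: derivative_eq_intros sum.cong)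
  from DERIV_neg_dec_right[OF this assms(2)] obtain e where
    "e > 0" and e: "\<And>h. 0 < h \<Longrightarrow> h < e \<Longrightarrow>
      (\<Sum>a\<in>A. p a * exp (h * X a)) < 1"
    using assms(1) by auto
  show ?thesis
    using \<open>e > 0\<close> e[of "e / 2"] by (intro exI[of _ "e / 2"]) auto
qed

text \<open>Since \<open>of_bool (x \<ge> 0) \<le> exp (\<theta> * x)\<close>, independence bounds
  the probability at time \<open>s\<close> by \<open>\<rho> ^ s\<close> with
  \<open>\<rho> < 1\<close>. The geometric series makes \<open>K\<close> independent of
  \<open>t\<close>.\<close>

lemma word_prob_sum_nonneg_summable:
  fixes X :: "'a \<Rightarrow> real"
  assumes p: "\<And>a. a \<in> A \<Longrightarrow> 0 \<le> p a" and p1: "sum p A = 1"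
    and neg: "(\<Sum>a\<in>A. p a * X a) < 0"
  shows "\<exists>K\<ge>0. \<forall>t. (\<Sum>s<t. word_expect A p s (\<lambda>zs. of_bool (sum_list (map X zs) \<ge> 0))) \<le> K"
proof -
  obtain \<theta> where \<theta>: "\<theta> > 0" and lt: "(\<Sum>a\<in>A. p a * exp (\<theta> * X a)) < 1"
    using exp_moment_less_one[OF p1 neg] by blast
  define \<rho> where "\<rho> = (\<Sum>a\<in>A. p a * exp (\<theta> * X a))"
  have \<rho>: "0 \<le> \<rho>" "\<rho> < 1"
    using lt p by (auto simp: \<rho>_def intro!: sum_nonneg)
  have le: "word_expect A p s (\<lambda>zs. of_bool (sum_list (map X zs) \<ge> 0)) \<le> \<rho> ^ s" for s
  proof -
    have "prod_list (map (\<lambda>a. exp (\<theta> * X a)) zs) = exp (\<theta> * sum_list (map X zs))" for zs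
      by (induction zs) (auto simp: distrib_left exp_add)
    moreover have "of_bool (x \<ge> 0) \<le> exp (\<theta> * x)" for x :: real
      using \<theta> by auto
    ultimately have "of_bool (sum_list (map X zs) \<ge> 0) \<le> prod_list (map (\<lambda>a. exp (\<theta> * X a)) zs)" for zs
      by simp
    then have "word_expect A p s (\<lambda>zs. of_bool (sum_list (map X zs) \<ge> 0))
        \<le> word_expect A p s (\<lambda>zs. prod_list (map (\<lambda>a. exp (\<theta> * X a)) zs))"
      by (intro word_expect_mono p)
    then show ?thesis by (simp add: word_expect_prod_list \<rho>_def)
  qed
  have "(\<Sum>s<t. word_expect A p s (\<lambda>zs. of_bool (sum_list (map X zs) \<ge> 0))) \<le> 1 / (1 - \<rho>)" for t
  proof -
    have "(\<Sum>s<t. word_expect A p s (\<lambda>zs. of_bool (sum_list (map X zs) \<ge> 0))) \<le> (\<Sum>s<t. \<rho> ^ s)"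
      by (intro sum_mono le)
    also have "\<dots> = (1 - \<rho> ^ t) / (1 - \<rho>)"
      using \<rho> sum_gp_strict[of \<rho> t] by auto
    also have "\<dots> \<le> 1 / (1 - \<rho>)"
      using \<rho> by (intro divide_right_mono) auto
    finally show ?thesis .
  qed
  then show ?thesis using \<rho> by (intro exI[of _ "1 / (1 - \<rho>)"]) auto
qed

subsection \<open>Conservative updates along a request sequence\<close>

lemma cms_est_le: "r \<in> {1..d} \<Longrightarrow> cms_est d hs C i \<le> C r (hs r i)"
  by (auto simp: cms_est_def intro!: Min_le)

lemma le_cms_est_iff:
  "d \<ge> 1 \<Longrightarrow> m \<le> cms_est d hs C i \<longleftrightarrow> (\<forall>r\<in>{1..d}. m \<le> C r (hs r i))"
  by (auto simp: cms_est_def)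

lemma cu_counters_Nil [simp]: "cu_counters d hs [] = (\<lambda>_ _. 0)"
  by (simp add: cu_counters_def)

lemma cu_counters_snoc [simp]:
  "cu_counters d hs (zs @ [z]) = cu_step d hs (cu_counters d hs zs) z"
  by (simp add: cu_counters_def)

text \<open>A request for \<open>i\<close> lifts each of its counters to at least the old estimate
  plus one, and no request ever lowers a counter.\<close>

lemma count_le_cms_est:
  assumes "d \<ge> 1"
  shows "count_list zs i \<le> cms_est d hs (cu_counters d hs zs) i"
proof (induction zs rule: rev_induct)
  case Nil
  then show ?case by simp
next
  case (snoc z zs)
  have "count_list (zs @ [z]) i \<le> cu_counters d hs (zs @ [z]) r (hs r i)" if r: "r \<in> {1..d}" for r
  proof -
    have "count_list zs i \<le> cu_counters d hs zs r (hs r i)"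
      using snoc cms_est_le[OF r] by (rule le_trans)
    with snoc r show ?thesis by (auto simp: cu_step_def)
  qed
  then show ?case using le_cms_est_iff[OF assms] by blast
qed

text \<open>An updated counter is at least the estimate of the requested item, so \<open>max\<close>
  raises it by at most one.\<close>

lemma cu_counters_le_hashed:
  "r \<in> {1..d} \<Longrightarrow> cu_counters d hs zs r c \<le> length (filter (\<lambda>z. hs r z = c) zs)"
proof (induction zs rule: rev_induct)
  case (snoc z zs)
  have "cms_est d hs (cu_counters d hs zs) z \<le> cu_counters d hs zs r (hs r z)"
    using snoc.prems by (rule cms_est_le)
  with snoc show ?case by (auto simp: cu_step_def)
qed simp

text \<open>Ties are included because \<open>j\<close> already raises the counter of
  \<open>i\<close> when its estimate equals that counter.\<close>

definition outnumbered :: "(nat \<Rightarrow> nat) \<Rightarrow> nat \<Rightarrow> nat \<Rightarrow> nat list \<Rightarrow> bool" where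
  "outnumbered h i j zs \<longleftrightarrow> count_list zs i \<le> length (filter (\<lambda>z. h z = h j) zs)"

text \<open>Following the row 1 counter instead of the estimate confines growth of the excess to
  requests hashed to one column.\<close>

lemma cu_counter_excess_step:
  fixes hs :: "nat \<Rightarrow> nat \<Rightarrow> nat" and i z :: nat
  assumes d: "d \<ge> 1"
  defines "c \<equiv> \<lambda>zs. real (cu_counters d hs zs 1 (hs 1 i))"
  shows "c (zs @ [z]) - count_list (zs @ [z]) i \<le> c zs - count_list zs i
    + of_bool (z \<noteq> i \<and> hs 1 z = hs 1 i \<and> (\<forall>r\<in>{1..d}. outnumbered (hs r) i z zs))"
proof -
  let ?C = "cu_counters d hs zs"
  have est_le: "cms_est d hs ?C x \<le> ?C 1 (hs 1 x)" for x
    using d by (intro cms_est_le) auto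
  consider "z = i" | "hs 1 z \<noteq> hs 1 i" | "z \<noteq> i" "hs 1 z = hs 1 i" by blast
  then show ?thesis
  proof cases
    \<comment> \<open>The counter rises by at most one while the count rises by exactly one.\<close>
    case 1
    then show ?thesis using est_le[of i] by (auto simp: c_def cu_step_def)
  next
    case 2
    then have "z \<noteq> i" by auto
    with 2 show ?thesis by (auto simp: c_def cu_step_def)
  next
    case 3
    show ?thesis
    proof (cases "cms_est d hs ?C z < ?C 1 (hs 1 i)")
      \<comment> \<open>The new value, estimate plus one, does not exceed the counter, so
        \<open>max\<close> leaves it unchanged.\<close>
      case True
      with 3 show ?thesis by (auto simp: c_def cu_step_def)
    next
      case False
      have "outnumbered (hs r) i z zs" if r: "r \<in> {1..d}" for r
      proof -
        have "count_list zs i \<le> ?C 1 (hs 1 i)"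
          using count_le_cms_est[OF d] est_le le_trans by blast
        also have "\<dots> \<le> cms_est d hs ?C z" using False by simp
        also have "\<dots> \<le> ?C r (hs r z)" using r by (rule cms_est_le)
        also have "\<dots> \<le> length (filter (\<lambda>x. hs r x = hs r z) zs)"
          using r by (rule cu_counters_le_hashed)
        finally show ?thesis by (simp add: outnumbered_def)
      qed
      with 3 show ?thesis using est_le[of z] by (auto simp: c_def cu_step_def)
    qed
  qed
qed

subsection \<open>Expected error for fixed hash functions\<close>

text \<open>The mass of \<open>j\<close> itself is included, so reaching \<open>p i\<close> requires
  \<open>p i - p j\<close> from the other items; this is the argument given to
  \<open>A_fun\<close>.\<close>

definition column_mass :: "nat \<Rightarrow> (nat \<Rightarrow> real) \<Rightarrow> (nat \<Rightarrow> nat) \<Rightarrow> nat \<Rightarrow> real" where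
  "column_mass N p h j = (\<Sum>l\<in>{1..N}. p l * of_bool (h l = h j))"

text \<open>In row 1 the collision already puts the mass of \<open>i\<close> into the column of
  \<open>j\<close>. The conditions concern separate rows, so the event factorises.\<close>

definition bad_hashes ::
  "nat \<Rightarrow> nat \<Rightarrow> (nat \<Rightarrow> real) \<Rightarrow> nat \<Rightarrow> nat \<Rightarrow> (nat \<Rightarrow> nat \<Rightarrow> nat) \<Rightarrow> bool" where
  "bad_hashes N d p i j hs \<longleftrightarrow>
     hs 1 j = hs 1 i \<and> (\<forall>r\<in>{2..d}. p i \<le> column_mass N p (hs r) j)"

text \<open>The lead of the column of \<open>j\<close> over \<open>i\<close> is a random walk with
  mean step \<open>column_mass N p h j - p i\<close>, negative by assumption.\<close>

lemma outnumbered_summable: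
  assumes p: "\<And>a. a \<in> {1..N} \<Longrightarrow> 0 \<le> p a" and p1: "sum p {1..N} = 1"
    and i: "i \<in> {1..N}" and less: "column_mass N p h j < p i"
  shows "\<exists>K\<ge>0. \<forall>t. (\<Sum>s<t. word_expect {1..N} p s (\<lambda>zs. of_bool (outnumbered h i j zs))) \<le> K"
proof -
  define X where "X z = of_bool (h z = h j) - (of_bool (z = i) :: real)" for z
  have "sum_list (map X zs) = real (length (filter (\<lambda>z. h z = h j) zs)) - count_list zs i" for zs
    by (induction zs) (auto simp: X_def)
  then have eq: "outnumbered h i j zs \<longleftrightarrow> 0 \<le> sum_list (map X zs)" for zs
    by (simp add: outnumbered_def)
  have "(\<Sum>a\<in>{1..N}. p a * X a) = column_mass N p h j - p i"
    using i by (simp add: X_def right_diff_distrib sum_subtractf column_mass_def of_bool_def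
        if_distrib[of "\<lambda>x. _ * x"] cong: if_cong)
  with less have "(\<Sum>a\<in>{1..N}. p a * X a) < 0" by simp
  from word_prob_sum_nonneg_summable[OF p p1 this] show ?thesis by (simp add: eq)
qed

text \<open>A drift argument: the expected one-step increase is summed over time. Bad hash choices
  contribute linearly in \<open>t\<close>; all the rest stays below a constant depending on
  \<open>hs\<close>.\<close>

lemma expected_excess_le:
  assumes p: "\<And>a. a \<in> {1..N} \<Longrightarrow> 0 \<le> p a" and p1: "sum p {1..N} = 1"
    and i: "i \<in> {1..N}" and d: "d \<ge> 1"
  shows "\<exists>B\<ge>0. \<forall>t. word_expect {1..N} p t (\<lambda>zs. cu_error d hs zs i)
    \<le> real t * (\<Sum>j\<in>{1..N} - {i}. p j * of_bool (bad_hashes N d p i j hs)) + B"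
proof -
  let ?E = "word_expect {1..N} p" and ?J = "{1..N} - {i}"
  define light where "light j = {r\<in>{2..d}. column_mass N p (hs r) j < p i}" for j
  define out where "out j r s = ?E s (\<lambda>zs. of_bool (outnumbered (hs r) i j zs))" for j r s
  \<comment> \<open>The guard sits inside the existential so that \<open>K\<close> becomes a total
    function of \<open>j\<close> and \<open>r\<close>.\<close>
  have "\<exists>K\<ge>0. r \<in> light j \<longrightarrow> (\<forall>t. (\<Sum>s<t. out j r s) \<le> K)" for j r
  proof (cases "r \<in> light j")
    case True
    then show ?thesis
      using outnumbered_summable[OF p p1 i, of "hs r" j] by (auto simp: light_def out_def)
  qed auto
  then have "\<forall>j r. \<exists>K\<ge>0. r \<in> light j \<longrightarrow> (\<forall>t. (\<Sum>s<t. out j r s) \<le> K)" by simp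
  then obtain K where K0: "\<And>j r. K j r \<ge> (0::real)"
    and K: "\<And>j r t. r \<in> light j \<Longrightarrow> (\<Sum>s<t. out j r s) \<le> K j r"
    by metis
  define exc where "exc zs = real (cu_counters d hs zs 1 (hs 1 i)) - count_list zs i" for zs
  define ev where "ev j zs = (hs 1 j = hs 1 i \<and> (\<forall>r\<in>{1..d}. outnumbered (hs r) i j zs))" for j zs
  define bad where "bad j = (of_bool (bad_hashes N d p i j hs) :: real)" for j
  \<comment> \<open>If \<open>j\<close> collides in row 1 but the choice is not bad, some row is
    light, and the event forces \<open>j\<close> to outnumber \<open>i\<close> in that row.\<close>
  have ev_le: "of_bool (ev j zs) \<le> bad j + (\<Sum>r\<in>light j. of_bool (outnumbered (hs r) i j zs))" for j zs
  proof (cases "ev j zs \<and> bad j = 0")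
    case True
    then obtain r where r: "r \<in> light j"
      by (auto simp: ev_def bad_def bad_hashes_def light_def not_le)
    then have "outnumbered (hs r) i j zs" using True by (auto simp: ev_def light_def)
    with r have "(1::real) \<le> (\<Sum>r\<in>light j. of_bool (outnumbered (hs r) i j zs))"
      using member_le_sum[of r "light j" "\<lambda>r. of_bool (outnumbered (hs r) i j zs) :: real"]
      by (auto simp: light_def)
    then show ?thesis by (auto simp: bad_def)
  next
    case False
    have "(0::real) \<le> (\<Sum>r\<in>light j. of_bool (outnumbered (hs r) i j zs))" by (intro sum_nonneg) auto
    with False show ?thesis by (auto simp: bad_def)
  qed
  have exc_Suc: "?E (Suc s) exc \<le> ?E s exc + (\<Sum>j\<in>?J. p j * (bad j + (\<Sum>r\<in>light j. out j r s)))" for s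
  proof -
    have "(\<Sum>z\<in>{1..N}. p z * exc (zs @ [z]))
        \<le> exc zs + (\<Sum>j\<in>?J. p j * (bad j + (\<Sum>r\<in>light j. of_bool (outnumbered (hs r) i j zs))))" for zs
    proof -
      have "(\<Sum>z\<in>{1..N}. p z * exc (zs @ [z])) \<le> (\<Sum>z\<in>{1..N}. p z * (exc zs + of_bool (z \<noteq> i \<and> ev z zs)))"
        using cu_counter_excess_step[OF d, where hs = hs and i = i and zs = zs] p
        by (intro sum_mono mult_left_mono) (auto simp: exc_def ev_def)
      also have "\<dots> = exc zs + (\<Sum>z\<in>{1..N}. p z * of_bool (z \<noteq> i \<and> ev z zs))"
        using p1 by (simp add: distrib_left sum.distrib flip: sum_distrib_right)
      also have "(\<Sum>z\<in>{1..N}. p z * of_bool (z \<noteq> i \<and> ev z zs)) = (\<Sum>z\<in>?J. p z * of_bool (ev z zs))"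
        by (rule sum.mono_neutral_cong_right) auto
      also have "\<dots> \<le> (\<Sum>j\<in>?J. p j * (bad j + (\<Sum>r\<in>light j. of_bool (outnumbered (hs r) i j zs))))"
        using p ev_le by (intro sum_mono mult_left_mono) auto
      finally show ?thesis by simp
    qed
    then have "?E (Suc s) exc
        \<le> ?E s (\<lambda>zs. exc zs + (\<Sum>j\<in>?J. p j * (bad j + (\<Sum>r\<in>light j. of_bool (outnumbered (hs r) i j zs)))))"
      unfolding word_expect_Suc by (intro word_expect_mono p)
    also have "\<dots> = ?E s exc + (\<Sum>j\<in>?J. p j * (bad j + (\<Sum>r\<in>light j. out j r s)))"
      by (simp add: word_expect_add word_expect_sum word_expect_cmult out_def
          word_expect_const[OF p1, simplified])
    finally show ?thesis .
  qed
  \<comment> \<open>The increments telescope from excess 0 on the empty word.\<close>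
  have exc_le: "?E t exc \<le> (\<Sum>s<t. \<Sum>j\<in>?J. p j * (bad j + (\<Sum>r\<in>light j. out j r s)))" for t
  proof (induction t)
    case 0
    then show ?case by (simp add: exc_def)
  next
    case (Suc t)
    then show ?case using exc_Suc[of t] by simp
  qed
  have swap: "(\<Sum>s<t. \<Sum>j\<in>?J. p j * (bad j + (\<Sum>r\<in>light j. out j r s)))
      = real t * (\<Sum>j\<in>?J. p j * bad j) + (\<Sum>j\<in>?J. p j * (\<Sum>r\<in>light j. \<Sum>s<t. out j r s))" for t
  proof -
    have "(\<Sum>s<t. p j * (bad j + (\<Sum>r\<in>light j. out j r s)))
        = real t * (p j * bad j) + p j * (\<Sum>r\<in>light j. \<Sum>s<t. out j r s)" for j
      by (subst sum.swap) (simp add: sum.distrib distrib_left sum_distrib_left)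
    then show ?thesis
      by (subst sum.swap) (simp add: sum.distrib sum_distrib_left)
  qed
  let ?B = "\<Sum>j\<in>?J. p j * (\<Sum>r\<in>light j. K j r)"
  have "?E t (\<lambda>zs. cu_error d hs zs i) \<le> real t * (\<Sum>j\<in>?J. p j * bad j) + ?B" for t
  proof -
    have "?E t (\<lambda>zs. cu_error d hs zs i) \<le> ?E t exc"
      using d by (intro word_expect_mono p) (auto simp: cu_error_def exc_def intro!: cms_est_le)
    also have "\<dots> \<le> real t * (\<Sum>j\<in>?J. p j * bad j) + (\<Sum>j\<in>?J. p j * (\<Sum>r\<in>light j. \<Sum>s<t. out j r s))"
      using exc_le[of t] by (simp only: swap)
    also have "(\<Sum>j\<in>?J. p j * (\<Sum>r\<in>light j. \<Sum>s<t. out j r s)) \<le> ?B"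
      using p K by (intro sum_mono mult_left_mono) auto
    finally show ?thesis by simp
  qed
  moreover have "?B \<ge> 0" using p K0 by (intro sum_nonneg mult_nonneg_nonneg) auto
  ultimately show ?thesis unfolding bad_def by blast
qed

subsection \<open>Averaging over the hash functions\<close>

text \<open>Splitting by the common column gives \<open>w\<close> disjoint events, each of
  probability \<open>1 / w^2\<close>.\<close>

lemma pairwise_indep_collision:
  assumes H: "pairwise_indep_family N w H" and w: "w \<ge> 1"
    and "x \<in> {1..N}" "y \<in> {1..N}" "x \<noteq> y"
  shows "real (card {h\<in>H. h x = h y}) = real (card H) / real w"
proof -
  have fin: "finite H" using H by (auto simp: pairwise_indep_family_def)
  have "{h\<in>H. h x = h y} = (\<Union>a\<in>{1..w}. {h\<in>H. h x = a \<and> h y = a})"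
    using H assms(3,4) by (auto simp: pairwise_indep_family_def)
  also have "card \<dots> = (\<Sum>a\<in>{1..w}. card {h\<in>H. h x = a \<and> h y = a})"
    using fin by (intro card_UN_disjoint) auto
  finally have "real (card {h\<in>H. h x = h y}) = (\<Sum>a\<in>{1..w}. real (card {h\<in>H. h x = a \<and> h y = a}))"
    by simp
  also have "\<dots> = (\<Sum>a\<in>{1..w}. real (card H) / (real w)\<^sup>2)"
    using H assms(3-5) by (intro sum.cong) (auto simp: pairwise_indep_family_def)
  also have "\<dots> = real (card H) / real w"
    using w by (simp add: power2_eq_square)
  finally show ?thesis .
qed

text \<open>For a heavy column, either some item of index at most \<open>k\<close> collides with
  \<open>j\<close> (union bound), or the later items supply mass \<open>p i - p j\<close>
  (Markov).\<close>

lemma card_heavy_column_le: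
  assumes H: "pairwise_indep_family N w H" and p: "\<And>a. a \<in> {1..N} \<Longrightarrow> 0 \<le> p a"
    and j: "j \<in> {1..N}" and less: "p j < p i" and k: "k < w"
  shows "real (card {h\<in>H. p i \<le> column_mass N p h j}) \<le> real (card H) *
    ((\<Sum>l\<in>{l\<in>{1..N}. l > k}. p l) / (real (w - k) * (p i - p j)) + real k / real w)"
proof -
  let ?x = "p i - p j"
  let ?T = "{l\<in>{1..N} - {j}. l \<le> k}" and ?U = "{l\<in>{1..N} - {j}. l > k}"
  have fin: "finite H" using H by (auto simp: pairwise_indep_family_def)
  have x: "?x > 0" using less by simp
  have pw: "of_bool (p i \<le> column_mass N p h j)
      \<le> (\<Sum>l\<in>?T. of_bool (h l = h j)) + (\<Sum>l\<in>?U. p l * of_bool (h l = h j)) / ?x" for h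
  proof (cases "\<exists>l\<in>?T. h l = h j")
    case True
    then obtain l where l: "l \<in> ?T" "h l = h j" by blast
    then have "(1::real) \<le> (\<Sum>l\<in>?T. of_bool (h l = h j))"
      using member_le_sum[of l ?T "\<lambda>l. of_bool (h l = h j) :: real"] by auto
    moreover have "0 \<le> (\<Sum>l\<in>?U. p l * of_bool (h l = h j)) / ?x"
      using p x by (intro divide_nonneg_pos sum_nonneg) auto
    ultimately show ?thesis by (auto simp: of_bool_def)
  next
    case False
    have "column_mass N p h j = p j + (\<Sum>l\<in>{1..N} - {j}. p l * of_bool (h l = h j))"
      unfolding column_mass_def using j by (subst sum.remove[of _ j]) auto
    also have "(\<Sum>l\<in>{1..N} - {j}. p l * of_bool (h l = h j)) = (\<Sum>l\<in>?U. p l * of_bool (h l = h j))"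
      using False by (intro sum.mono_neutral_right) (auto simp: not_le[symmetric])
    finally have "p i \<le> column_mass N p h j \<Longrightarrow> 1 \<le> (\<Sum>l\<in>?U. p l * of_bool (h l = h j)) / ?x"
      using x by simp
    moreover have "0 \<le> (\<Sum>l\<in>?U. p l * of_bool (h l = h j)) / ?x"
      using p x by (intro divide_nonneg_pos sum_nonneg) auto
    moreover have "(0::real) \<le> (\<Sum>l\<in>?T. of_bool (h l = h j))" by (intro sum_nonneg) auto
    ultimately show ?thesis by (auto simp: of_bool_def)
  qed
  have coll: "(\<Sum>h\<in>H. of_bool (h l = h j)) = real (card H) / real w" if "l \<in> {1..N} - {j}" for l
    using pairwise_indep_collision[OF H, of l j] that j k fin by (auto simp: of_bool_def sum.If_cases Int_def)
  have "real (card {h\<in>H. p i \<le> column_mass N p h j}) = (\<Sum>h\<in>H. of_bool (p i \<le> column_mass N p h j))"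
    using fin by (simp add: of_bool_def sum.If_cases Int_def)
  also have "\<dots> \<le> (\<Sum>h\<in>H. (\<Sum>l\<in>?T. of_bool (h l = h j)) + (\<Sum>l\<in>?U. p l * of_bool (h l = h j)) / ?x)"
    by (intro sum_mono pw)
  also have "\<dots> = (\<Sum>l\<in>?T. \<Sum>h\<in>H. of_bool (h l = h j)) + (\<Sum>l\<in>?U. p l * (\<Sum>h\<in>H. of_bool (h l = h j))) / ?x"
    unfolding sum.distrib sum_divide_distrib[symmetric] sum_distrib_left
    by (subst (1 2) sum.swap[of _ _ H]) simp
  also have "\<dots> = (\<Sum>l\<in>?T. real (card H) / real w) + (\<Sum>l\<in>?U. p l * (real (card H) / real w)) / ?x"
    by (intro arg_cong2[where f="(+)"] arg_cong2[where f="(/)"] sum.cong refl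
        arg_cong2[where f="(*)"] coll) auto
  also have "\<dots> = real (card H) * (sum p ?U / (real w * ?x) + real (card ?T) / real w)"
    unfolding sum_distrib_right[symmetric] by (simp add: field_simps)
  \<comment> \<open>The count so far has denominator \<open>w\<close>; the smaller
    \<open>w - k\<close>, positive as \<open>k < w\<close>, only enlarges the bound and gives the
    form used in \<open>A_fun\<close>.\<close>
  also have "\<dots> \<le> real (card H) *
      ((\<Sum>l\<in>{l\<in>{1..N}. l > k}. p l) / (real (w - k) * ?x) + real k / real w)"
  proof (intro mult_left_mono add_mono frac_le divide_right_mono)
    show "sum p ?U \<le> (\<Sum>l\<in>{l\<in>{1..N}. l > k}. p l)"
      using p by (intro sum_mono2) auto
    show "0 \<le> (\<Sum>l\<in>{l\<in>{1..N}. l > k}. p l)"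
      using p by (intro sum_nonneg) auto
    have "card ?T \<le> card {1..k}" by (intro card_mono) auto
    then show "real (card ?T) \<le> real k" by simp
  qed (use x k in auto)
  finally show ?thesis .
qed

lemma card_heavy_column_le_A_fun:
  assumes H: "pairwise_indep_family N w H" and p: "\<And>a. a \<in> {1..N} \<Longrightarrow> 0 \<le> p a"
    and j: "j \<in> {1..N}" and le: "p j \<le> p i" and w: "w \<ge> 1"
  shows "real (card {h\<in>H. p i \<le> column_mass N p h j}) \<le> real (card H) * A_fun N w p (p i - p j)"
proof (cases "p i = p j")
  \<comment> \<open>Here \<open>A_fun\<close> is 1 by its convention at 0, leaving the trivial bound
    \<open>card H\<close>.\<close>
  case True
  have "finite H" using H by (auto simp: pairwise_indep_family_def)
  with True show ?thesis by (auto simp: A_fun_def intro!: card_mono)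
next
  case False
  let ?a = "\<lambda>k. (\<Sum>l\<in>{l\<in>{1..N}. l > k}. p l) / (real (w - k) * (p i - p j)) + real k / real w"
  \<comment> \<open>The minimum is attained, so the bound for that single \<open>k\<close>
    suffices.\<close>
  have "Min (?a ` {0..w-1}) \<in> ?a ` {0..w-1}" by (intro Min_in) auto
  then obtain k where "k \<in> {0..w-1}" "Min (?a ` {0..w-1}) = ?a k" by blast
  moreover have "A_fun N w p (p i - p j) = Min (?a ` {0..w-1})"
    using False by (simp add: A_fun_def)
  moreover have "k < w" using \<open>k \<in> {0..w-1}\<close> w by auto
  ultimately show ?thesis
    using card_heavy_column_le[where p = p, OF H p j, of i k] False le by simp
qed

text \<open>Independence of rows appears as a product set: collisions in row 1, heavy columns in the
  other \<open>d - 1\<close> rows.\<close>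

lemma card_bad_hashes:
  assumes H: "pairwise_indep_family N w H" and d: "d \<ge> 1" and w: "w \<ge> 1"
    and ij: "i \<in> {1..N}" "j \<in> {1..N}" "i \<noteq> j"
  shows "real (card {hs \<in> {1..d} \<rightarrow>\<^sub>E H. bad_hashes N d p i j hs})
    = real (card H) / real w * real (card {h\<in>H. p i \<le> column_mass N p h j}) ^ (d - 1)"
proof -
  let ?C = "{h\<in>H. h j = h i}" and ?D = "{h\<in>H. p i \<le> column_mass N p h j}"
  have ins: "{1..d} = insert 1 {2..d}" using d by auto
  have "{hs \<in> {1..d} \<rightarrow>\<^sub>E H. bad_hashes N d p i j hs} = PiE {1..d} (\<lambda>r. if r = 1 then ?C else ?D)"
    unfolding ins by (rule set_eqI) (auto simp: bad_hashes_def PiE_iff)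
  then have "card {hs \<in> {1..d} \<rightarrow>\<^sub>E H. bad_hashes N d p i j hs}
      = (\<Prod>r\<in>insert 1 {2..d}. card (if r = 1 then ?C else ?D))"
    by (simp only: card_PiE finite_atLeastAtMost ins[symmetric])
  also have "\<dots> = card ?C * (\<Prod>r\<in>{2..d}. card (if r = 1 then ?C else ?D))"
    by simp
  also have "(\<Prod>r\<in>{2..d}. card (if r = 1 then ?C else ?D)) = (\<Prod>r\<in>{2..d}. card ?D)"
    by (intro prod.cong) auto
  also have "\<dots> = card ?D ^ (d - 1)"
    by simp
  finally have "card {hs \<in> {1..d} \<rightarrow>\<^sub>E H. bad_hashes N d p i j hs} = card ?C * card ?D ^ (d - 1)" .
  then show ?thesis
    using pairwise_indep_collision[OF H w ij(2,1)] ij(3) by simp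
qed

text \<open>The collision in row 1 yields the factor \<open>1 / w\<close>; the other rows yield
  \<open>gamma\<close>. For \<open>j \<le> i\<close> the difference \<open>p i - p j\<close> is not
  positive, and only the trivial bound 1 enters.\<close>

lemma card_bad_hashes_le_gamma:
  assumes H: "pairwise_indep_family N w H" and p: "\<And>a. a \<in> {1..N} \<Longrightarrow> 0 \<le> p a"
    and anti: "\<forall>j k. 1 \<le> j \<longrightarrow> j \<le> k \<longrightarrow> k \<le> N \<longrightarrow> p k \<le> p j"
    and d: "d \<ge> 1" and w: "w \<ge> 1" and ij: "i \<in> {1..N}" "j \<in> {1..N}" "i \<noteq> j"
  shows "real (card {hs \<in> {1..d} \<rightarrow>\<^sub>E H. bad_hashes N d p i j hs})
    \<le> real (card H ^ d) * (gamma N d w p i j / real w)"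
proof -
  let ?D = "{h\<in>H. p i \<le> column_mass N p h j}" and ?n = "real (card H)"
  have "finite H" using H by (auto simp: pairwise_indep_family_def)
  then have "real (card ?D) \<le> ?n" by (auto intro: card_mono)
  then have 1: "real (card ?D) ^ (d - 1) \<le> ?n ^ (d - 1)" by (intro power_mono) auto
  have 2: "real (card ?D) ^ (d - 1) \<le> ?n ^ (d - 1) * A_fun N w p (p i - p j) ^ (d - 1)" if "i < j"
  proof -
    have "p j \<le> p i" using anti ij that by auto
    then have "real (card ?D) \<le> ?n * A_fun N w p (p i - p j)"
      using card_heavy_column_le_A_fun[where p = p, OF H p ij(2)] w by blast
    then show ?thesis unfolding power_mult_distrib[symmetric] by (intro power_mono) simp_all
  qed
  have "real (card ?D) ^ (d - 1) \<le> ?n ^ (d - 1) * gamma N d w p i j"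
    using 1 2 by (auto simp: gamma_def min_def)
  then have "?n / real w * real (card ?D) ^ (d - 1) \<le> ?n / real w * (?n ^ (d - 1) * gamma N d w p i j)"
    by (intro mult_left_mono) auto
  also have "\<dots> = real (card H ^ d) * (gamma N d w p i j / real w)"
    using d by (cases d) auto
  finally show ?thesis by (simp only: card_bad_hashes[OF H d w ij])
qed

section \<open>Averaging the bound for fixed hash functions\<close>

theorem theorem1:
  fixes N d w :: nat and p :: "nat \<Rightarrow> real" and H :: "(nat \<Rightarrow> nat) set" and i :: nat
  assumes "d \<ge> 1" and "w \<ge> 1"
    and "\<forall>j\<in>{1..N}. p j \<ge> 0"
    and "(\<Sum>j\<in>{1..N}. p j) = 1"
    and "\<forall>j k. 1 \<le> j \<longrightarrow> j \<le> k \<longrightarrow> k \<le> N \<longrightarrow> p k \<le> p j"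
    and "pairwise_indep_family N w H"
    and "i \<in> {1..N}"
  shows "\<exists>B\<ge>0. \<forall>t\<ge>1. expected_error_ratio N d H p i t
           \<le> (1 / real w) * (\<Sum>j\<in>{1..N} - {i}. p j * gamma N d w p i j) + B / real t"
proof -
  let ?P = "{1..d} \<rightarrow>\<^sub>E H" and ?J = "{1..N} - {i}" and ?n = "real (card H ^ d)"
  have p: "\<And>a. a \<in> {1..N} \<Longrightarrow> 0 \<le> p a" using assms(3) by auto
  have H: "finite H" "H \<noteq> {}" using assms(6) by (auto simp: pairwise_indep_family_def)
  then have n: "?n > 0" by (simp add: card_gt_0_iff)
  have fin: "finite ?P" using H by (intro finite_PiE) auto
  have "\<forall>hs. \<exists>B\<ge>0. \<forall>t. word_expect {1..N} p t (\<lambda>zs. cu_error d hs zs i)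
      \<le> real t * (\<Sum>j\<in>?J. p j * of_bool (bad_hashes N d p i j hs)) + B"
    using expected_excess_le[OF p assms(4,7,1)] by blast
  then obtain B where B0: "\<And>hs. B hs \<ge> 0"
    and B: "\<And>hs t. word_expect {1..N} p t (\<lambda>zs. cu_error d hs zs i)
      \<le> real t * (\<Sum>j\<in>?J. p j * of_bool (bad_hashes N d p i j hs)) + B hs"
    by metis
  \<comment> \<open>The witness is the average of the constants \<open>B hs\<close> over the
    finitely many hash choices, hence free of \<open>t\<close>.\<close>
  have "expected_error_ratio N d H p i t
      \<le> (1 / real w) * (\<Sum>j\<in>?J. p j * gamma N d w p i j) + (sum B ?P / ?n) / real t"
    if t: "t \<ge> 1" for t
  proof -
    have "expected_error_ratio N d H p i t
        = (\<Sum>hs\<in>?P. word_expect {1..N} p t (\<lambda>zs. cu_error d hs zs i)) / real t / ?n"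
      by (simp add: expected_error_ratio_def word_expect_def sum_divide_distrib)
    also have "\<dots> \<le> (\<Sum>hs\<in>?P. real t * (\<Sum>j\<in>?J. p j * of_bool (bad_hashes N d p i j hs)) + B hs)
        / real t / ?n"
      by (intro divide_right_mono sum_mono B) auto
    also have "\<dots> = (\<Sum>hs\<in>?P. \<Sum>j\<in>?J. p j * of_bool (bad_hashes N d p i j hs)) / ?n
        + (sum B ?P / ?n) / real t"
      using t by (simp add: sum.distrib add_divide_distrib flip: sum_distrib_left)
    \<comment> \<open>Exchanging the sums turns the indicators into the number of bad choices for
      each \<open>j\<close>.\<close>
    also have "(\<Sum>hs\<in>?P. \<Sum>j\<in>?J. p j * of_bool (bad_hashes N d p i j hs))
        = (\<Sum>j\<in>?J. p j * real (card {hs \<in> ?P. bad_hashes N d p i j hs}))"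
      using fin by (subst sum.swap) (simp add: of_bool_def sum.If_cases Int_def flip: sum_distrib_left)
    also have "\<dots> \<le> (\<Sum>j\<in>?J. p j * (?n * (gamma N d w p i j / real w)))"
      using p assms(7) card_bad_hashes_le_gamma[OF assms(6) p assms(5,1,2)]
      by (intro sum_mono mult_left_mono) auto
    also have "\<dots> = ?n * ((1 / real w) * (\<Sum>j\<in>?J. p j * gamma N d w p i j))"
      by (simp add: sum_distrib_left algebra_simps)
    also have "\<dots> / ?n = (1 / real w) * (\<Sum>j\<in>?J. p j * gamma N d w p i j)"
      using n by (intro nonzero_mult_div_cancel_left) simp
    finally show ?thesis using n by (simp add: divide_right_mono)
  qed
  moreover have "sum B ?P / ?n \<ge> 0" using B0 n by (intro divide_nonneg_pos sum_nonneg) auto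
  ultimately show ?thesis by blast
qed

end
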